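(* Generalized Christoffel–Darboux relations: $$(x-x')K^N_{11}(x,x')=\gamma(N-1)\psi_N(x)\underline\phi_{N-1}(x')-\sum_{j=1}^{d_2}\sum_{k=0}^{j-1}\alpha_j(N+k)\underline\phi_{N+k}(x')\psi_{N+k-j}(x)=-\underline\Phi^{N-1}(x')\,\mathbb A^N\,\Psi_N(x)\qquad(N\ge d_2),$$ $$(y'-y)K^N_{22}(y',y)=-\gamma(N-1)\underline\psi_{N-1}(y')\phi_N(y)+\sum_{j=1}^{d_1}\sum_{k=0}^{j-1}\beta_j(N+k)\underline\psi_{N+k}(y')\phi_{N-j+k}(y)=\underline\Psi^{N-1}(y')\,\mathbb B^N\,\Phi_N(y)\qquad(N\ge d_1).$$ "Differential" generalized Christoffel–Darboux relations: $$(\partial_{x'}+\partial_x)K^N_{11}(x,x')=-\underline\Phi_N(x')\,(\mathbb B^N)^t\,\Psi^{N-1}(x)\qquad(N\ge d_1),$$ $$(\partial_{y'}+\partial_y)K^N_{22}(y',y)=-\underline\Psi_N(y')\,(\mathbb A^N)^t\,\Phi^{N-1}(y)\qquad(N\ge d_2).$$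
   Context: **Setting.** Fix integers $d_1,d_2\ge1$ and $V_1(x)=\sum_{K=1}^{d_1+1}\frac{u_K}{K}x^K$, $V_2(y)=\sum_{J=1}^{d_2+1}\frac{v_J}{J}y^J$ with $u_{d_1+1}\ne0$, $v_{d_2+1}\ne0$, and contours $\Gamma_x,\Gamma_y$ such that all integrals below converge and integrations by parts produce no boundary terms. Assume there are monic polynomials $\pi_n,\sigma_n$ of degree $n$ ($n\ge0$) with $\int_{\Gamma_x}\int_{\Gamma_y}\pi_n(x)\sigma_m(y)e^{-V_1(x)-V_2(y)+xy}\,dy\,dx=h_n\delta_{nm}$, $h_n\neq0$. Fix $\sqrt{h_n}$ and put $\psi_n(x)=\pi_n(x)e^{-V_1(x)}/\sqrt{h_n}$, $\phi_n(y)=\sigma_n(y)e^{-V_2(y)}/\sqrt{h_n}$, and $\underline\psi_n(y)=\int_{\Gamma_x}e^{xy}\psi_n(x)\,dx$, $\underline\phi_n(x)=\int_{\Gamma_y}e^{xy}\phi_n(y)\,dy$. **Recursion coefficients.** There are unique numbers $\alpha_j(n)$ ($-1\le j\le d_2$), $\beta_j(n)$ ($-1\le j\le d_1$), with $\alpha_{-1}(n)=\beta_{-1}(n)=\gamma(n)=\sqrt{h_{n+1}}/\sqrt{h_n}$ and $\alpha_j(n)=\beta_j(n)=0$ for $n<j$, such that for all $n\ge0$ (terms with negative index omitted) $x\psi_n=\sum_{j=-1}^{d_2}\alpha_j(n)\psi_{n-j}$, $\partial_x\psi_n=-\sum_{j=-1}^{d_1}\beta_j(n+j)\psi_{n+j}$,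 $y\phi_n=\sum_{j=-1}^{d_1}\beta_j(n)\phi_{n-j}$, $\partial_y\phi_n=-\sum_{j=-1}^{d_2}\alpha_j(n+j)\phi_{n+j}$. **Kernels.** $K^N_{11}(x,x')=\sum_{n=0}^{N-1}\psi_n(x)\underline\phi_n(x')$, $K^N_{22}(y',y)=\sum_{n=0}^{N-1}\underline\psi_n(y')\phi_n(y)$. **Windows.** Column vectors: $\Psi_N=[\psi_{N-d_2},\dots,\psi_N]^t$, $\Phi_N=[\phi_{N-d_1},\dots,\phi_N]^t$, $\Psi^N=[\psi_N,\dots,\psi_{N+d_1}]^t$, $\Phi^N=[\phi_N,\dots,\phi_{N+d_2}]^t$. Row vectors: $\underline\Psi_N=[\underline\psi_{N-d_2},\dots,\underline\psi_N]$, $\underline\Phi_N=[\underline\phi_{N-d_1},\dots,\underline\phi_N]$, $\underline\Psi^N=[\underline\psi_N,\dots,\underline\psi_{N+d_1}]$, $\underline\Phi^N=[\underline\phi_N,\dots,\underline\phi_{N+d_2}]$. **Christoffel–Darboux matrices** (indices from $0$). $\mathbb A^N$ is $(d_2+1)\times(d_2+1)$ with $(\mathbb A^N)_{0,d_2}=-\gamma(N-1)$, $(\mathbb A^N)_{k+1,c}=\alpha_{d_2+k-c}(N+k)$ for $0\le k\le c\le d_2-1$, other entries $0$. $\mathbb B^N$ is $(d_1+1)\times(d_1+1)$ with $(\mathbb B^N)_{0,d_1}=-\gamma(N-1)$, $(\mathbb B^N)_{k+1,c}=\beta_{d_1+k-c}(N+k)$ for $0\le k\le c\le d_1-1$, other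 entries $0$. *)

theory Defs
  imports
    "HOL-Analysis.Analysis"
    "Jordan_Normal_Form.Matrix"
begin

text \<open>
  Integrals such as the moments of \<open>exp (- V x)\<close> for a polynomial \<open>V\<close> need contours going to infinity
  at both ends, so the library's path integrals over \<open>{0..1}\<close> do not apply.  A contour is a finite
  formal linear combination of curves \<open>g :: real \<Rightarrow> complex\<close>, given as a list of pairs
  (coefficient, curve); a single curve is \<open>[(1, g)]\<close>.
\<close>

type_synonym contour = "(complex \<times> (real \<Rightarrow> complex)) list"

definition is_contour :: "contour \<Rightarrow> bool" where
  "is_contour \<Gamma> \<longleftrightarrow> (\<forall>(w, g) \<in> set \<Gamma>. \<forall>a b. g piecewise_C1_differentiable_on {a..b})"

definition cint_converges :: "contour \<Rightarrow> (complex \<Rightarrow> complex) \<Rightarrow> bool" where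
  "cint_converges \<Gamma> f \<longleftrightarrow>
     (\<forall>(w, g) \<in> set \<Gamma>. integrable lborel (\<lambda>t. f (g t) * vector_derivative g (at t)))"

definition cint :: "contour \<Rightarrow> (complex \<Rightarrow> complex) \<Rightarrow> complex" where
  "cint \<Gamma> f = (\<Sum>(w, g) \<leftarrow> \<Gamma>. w * (LINT t|lborel. f (g t) * vector_derivative g (at t)))"

definition potential :: "nat \<Rightarrow> (nat \<Rightarrow> complex) \<Rightarrow> complex \<Rightarrow> complex" where
  "potential d u x = (\<Sum>K = 1..d + 1. u K / of_nat K * x ^ K)"

text \<open>
  The integrals involved are single integrals of \<open>exp (x * y)\<close> times a polynomial times a weight,
  and the iterated integrals of the pairing.  That integration by parts produces no boundary term
  means that the total derivative of the integrand integrates to \<open>0\<close>.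
\<close>

definition admissible_contours ::
    "(complex \<Rightarrow> complex) \<Rightarrow> (complex \<Rightarrow> complex) \<Rightarrow> contour \<Rightarrow> contour \<Rightarrow> bool" where
  "admissible_contours V1 V2 \<Gamma>x \<Gamma>y \<longleftrightarrow>
     is_contour \<Gamma>x \<and> is_contour \<Gamma>y \<and>
     (\<forall>p y. cint_converges \<Gamma>x (\<lambda>x. poly p x * exp (- V1 x + x * y))) \<and>
     (\<forall>q x. cint_converges \<Gamma>y (\<lambda>y. poly q y * exp (- V2 y + x * y))) \<and>
     (\<forall>p q. cint_converges \<Gamma>x
        (\<lambda>x. cint \<Gamma>y (\<lambda>y. poly p x * poly q y * exp (- V1 x - V2 y + x * y)))) \<and>
     (\<forall>p y. cint \<Gamma>x (deriv (\<lambda>x. poly p x * exp (- V1 x + x * y))) = 0) \<and>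
     (\<forall>q x. cint \<Gamma>y (deriv (\<lambda>y. poly q y * exp (- V2 y + x * y))) = 0) \<and>
     (\<forall>p q. cint \<Gamma>x (deriv
        (\<lambda>x. cint \<Gamma>y (\<lambda>y. poly p x * poly q y * exp (- V1 x - V2 y + x * y)))) = 0)"

definition monic_of_degree :: "complex poly \<Rightarrow> nat \<Rightarrow> bool" where
  "monic_of_degree p n \<longleftrightarrow> degree p = n \<and> lead_coeff p = 1"

definition pairing ::
    "(complex \<Rightarrow> complex) \<Rightarrow> (complex \<Rightarrow> complex) \<Rightarrow> contour \<Rightarrow> contour \<Rightarrow>
     complex poly \<Rightarrow> complex poly \<Rightarrow> complex" where
  "pairing V1 V2 \<Gamma>x \<Gamma>y p q =
     cint \<Gamma>x (\<lambda>x. cint \<Gamma>y (\<lambda>y. poly p x * poly q y * exp (- V1 x - V2 y + x * y)))"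

text \<open>
  \<open>wave V p r\<close> is \<open>\<psi>\<close> (or \<open>\<phi>\<close>), with \<open>r n\<close> the chosen square root of \<open>h n\<close>;
  \<open>dual \<Gamma> f\<close> is the corresponding underlined sequence of functions.
\<close>

definition wave ::
    "(complex \<Rightarrow> complex) \<Rightarrow> (nat \<Rightarrow> complex poly) \<Rightarrow> (nat \<Rightarrow> complex) \<Rightarrow> nat \<Rightarrow> complex \<Rightarrow> complex" where
  "wave V p r n x = poly (p n) x * exp (- V x) / r n"

definition dual :: "contour \<Rightarrow> (nat \<Rightarrow> complex \<Rightarrow> complex) \<Rightarrow> nat \<Rightarrow> complex \<Rightarrow> complex" where
  "dual \<Gamma> f n y = cint \<Gamma> (\<lambda>x. exp (x * y) * f n x)"

text \<open>
  The coefficient \<open>a\<^sub>j(n)\<close> is \<open>a j n\<close>; the index \<open>j\<close> is an integer because it starts at \<open>-1\<close>.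
  The guards in the summation sets drop the terms whose index would be negative.
\<close>

definition multiplication_recursion ::
    "nat \<Rightarrow> (int \<Rightarrow> nat \<Rightarrow> complex) \<Rightarrow> (nat \<Rightarrow> complex \<Rightarrow> complex) \<Rightarrow> bool" where
  "multiplication_recursion d a f \<longleftrightarrow>
     (\<forall>n x. x * f n x =
        (\<Sum>j \<in> {j \<in> {-1..int d}. 0 \<le> int n - j}. a j n * f (nat (int n - j)) x))"

definition derivative_recursion ::
    "nat \<Rightarrow> (int \<Rightarrow> nat \<Rightarrow> complex) \<Rightarrow> (nat \<Rightarrow> complex \<Rightarrow> complex) \<Rightarrow> bool" where
  "derivative_recursion d a f \<longleftrightarrow>
     (\<forall>n x. deriv (f n) x =
        - (\<Sum>j \<in> {j \<in> {-1..int d}. 0 \<le> int n + j}.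
             a j (nat (int n + j)) * f (nat (int n + j)) x))"

definition kernel ::
    "(nat \<Rightarrow> complex \<Rightarrow> complex) \<Rightarrow> (nat \<Rightarrow> complex \<Rightarrow> complex) \<Rightarrow> nat \<Rightarrow> complex \<Rightarrow> complex \<Rightarrow> complex" where
  "kernel f g N s t = (\<Sum>n<N. f n s * g n t)"

text \<open>
  The windows \<open>[f\<^sub>N\<^sub>-\<^sub>d, \<dots>, f\<^sub>N]\<close> (used only for \<open>d \<le> N\<close>) and \<open>[f\<^sub>N, \<dots>, f\<^sub>N\<^sub>+\<^sub>d]\<close> at \<open>z\<close>.  Vectors carry no
  row/column distinction: \<open>row_mat_col r M c\<close> is the product of the row \<open>r\<close>, the matrix \<open>M\<close> and
  the column \<open>c\<close>.
\<close>

definition lower_window :: "nat \<Rightarrow> (nat \<Rightarrow> complex \<Rightarrow> complex) \<Rightarrow> nat \<Rightarrow> complex \<Rightarrow> complex Matrix.vec" where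
  "lower_window d f N z = Matrix.vec (d + 1) (\<lambda>i. f (N - d + i) z)"

definition upper_window :: "nat \<Rightarrow> (nat \<Rightarrow> complex \<Rightarrow> complex) \<Rightarrow> nat \<Rightarrow> complex \<Rightarrow> complex Matrix.vec" where
  "upper_window d f N z = Matrix.vec (d + 1) (\<lambda>i. f (N + i) z)"

definition row_mat_col :: "complex Matrix.vec \<Rightarrow> complex Matrix.mat \<Rightarrow> complex Matrix.vec \<Rightarrow> complex" where
  "row_mat_col r M c = scalar_prod r (M *\<^sub>v c)"

text \<open>
  Below row \<open>0\<close>, row \<open>i = k + 1\<close> has the entries \<open>a\<^sub>d\<^sub>+\<^sub>k\<^sub>-\<^sub>c(N + k)\<close> in the columns \<open>k \<le> c \<le> d - 1\<close>.
\<close>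

definition cd_matrix ::
    "nat \<Rightarrow> (nat \<Rightarrow> complex) \<Rightarrow> (int \<Rightarrow> nat \<Rightarrow> complex) \<Rightarrow> nat \<Rightarrow> complex Matrix.mat" where
  "cd_matrix d \<gamma> a N = Matrix.mat (d + 1) (d + 1) (\<lambda>(i, c).
     if i = 0 then (if c = d then - \<gamma> (N - 1) else 0)
     else let k = i - 1 in
       if k \<le> c \<and> c < d then a (int d + int k - int c) (N + k) else 0)"

end

theory Submission
  imports Defs
begin

text \<open>
  Differentiation under the integral sign and integration by parts show that the two recursions of
  a sequence carry over to its dual sequence with the roles of multiplication and differentiation
  exchanged.  Each of the four relations is then an instance of one identity: if \<open>DF\<close> and \<open>DG\<close> are
  obtained from \<open>F\<close> and \<open>G\<close> by a finite-band matrix and by its transpose, then in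
  \<open>\<Sum>n<N. DF n * G n - F n * DG n\<close> all terms cancel except those of the band that cross \<open>N\<close>.
\<close>

section \<open>Telescoping\<close>

text \<open>The guard moves from the index set into the summand, so that the range of
  \<open>j\<close> no longer depends on \<open>n\<close> and sums over \<open>n\<close> and
  \<open>j\<close> can be exchanged. The index \<open>-1\<close> is never dropped, because
  \<open>n + 1\<close> is nonnegative.\<close>

lemma sum_down_guarded:
  fixes T :: "int \<Rightarrow> complex"
  shows "(\<Sum>j \<in> {j \<in> {-1..int d}. 0 \<le> int n - j}. T j) =
    T (-1) + (\<Sum>j\<le>d. if j \<le> n then T (int j) else 0)"
proof -
  have "{j \<in> {-1..int d}. 0 \<le> int n - j} = insert (-1) (int ` {j \<in> {..d}. j \<le> n})"
  proof (rule Set.set_eqI)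
    fix j show "j \<in> {j \<in> {-1..int d}. 0 \<le> int n - j} \<longleftrightarrow>
        j \<in> insert (-1) (int ` {j \<in> {..d}. j \<le> n})"
      by (cases j) (auto simp: image_iff)
  qed
  then have "(\<Sum>j \<in> {j \<in> {-1..int d}. 0 \<le> int n - j}. T j) = T (-1) + (\<Sum>j\<in>{j \<in> {..d}. j \<le> n}. T (int j))"
    by (subst \<open>_ = _\<close>, subst sum.insert) (auto simp: sum.reindex)
  also have "(\<Sum>j\<in>{j \<in> {..d}. j \<le> n}. T (int j)) = (\<Sum>j\<le>d. if j \<le> n then T (int j) else 0)"
    by (rule sum.inter_filter) simp
  finally show ?thesis .
qed

text \<open>Here the guard can drop only the index \<open>-1\<close>, and only at
  \<open>n = 0\<close>.\<close>

lemma sum_up_guarded: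
  fixes T :: "int \<Rightarrow> complex"
  shows "(\<Sum>j \<in> {j \<in> {-1..int d}. 0 \<le> int n + j}. T j) =
    (if 1 \<le> n then T (-1) else 0) + (\<Sum>j\<le>d. T (int j))"
proof -
  have "{j \<in> {-1..int d}. 0 \<le> int n + j} = (if 1 \<le> n then {-1} else {}) \<union> int ` {..d}"
  proof (rule Set.set_eqI)
    fix j show "j \<in> {j \<in> {-1..int d}. 0 \<le> int n + j} \<longleftrightarrow>
        j \<in> (if 1 \<le> n then {-1} else {}) \<union> int ` {..d}"
      by (cases j) (auto simp: image_iff)
  qed
  then show ?thesis
    by (subst \<open>_ = _\<close>, subst sum.union_disjoint) (auto simp: sum.reindex)
qed

text \<open>The first sum takes \<open>b\<close> at \<open>j, ..., N - 1\<close> and the second at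
  \<open>j, ..., N + j - 1\<close>, so only the block of length \<open>j\<close> starting at
  \<open>N\<close> survives. The induction starts at \<open>N = j\<close>, where the first sum
  vanishes.\<close>

lemma sum_shift_diff:
  fixes b :: "nat \<Rightarrow> complex"
  assumes "j \<le> N"
  shows "(\<Sum>n<N. if j \<le> n then b n else 0) - (\<Sum>n<N. b (n + j)) = - (\<Sum>k<j. b (N + k))"
  using assms
proof (induction N rule: dec_induct)
  case base
  then show ?case by (simp add: add.commute)
next
  case (step M)
  let ?A = "\<Sum>n<M. if j \<le> n then b n else 0" and ?B = "\<Sum>n<M. b (n + j)"
  have "(\<Sum>k<j. b (M + k)) + b (M + j) = b M + (\<Sum>k<j. b (Suc M + k))"
    using sum.lessThan_Suc_shift[of "\<lambda>k. b (M + k)" j] by simp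
  then have shift: "(\<Sum>k<j. b (Suc M + k)) = (\<Sum>k<j. b (M + k)) + b (M + j) - b M"
    by (simp only: add_diff_cancel_left')
  have "(\<Sum>n<Suc M. if j \<le> n then b n else 0) - (\<Sum>n<Suc M. b (n + j)) =
      (?A - ?B) + (b M - b (M + j))"
    using step.hyps by (simp add: algebra_simps)
  also have "\<dots> = - (\<Sum>k<j. b (Suc M + k))"
    unfolding step.IH shift by simp
  finally show ?case .
qed

lemma band_commutator_sum:
  fixes F G DF DG :: "nat \<Rightarrow> complex" and a :: "int \<Rightarrow> nat \<Rightarrow> complex"
  assumes DF: "\<And>n. DF n = (\<Sum>j \<in> {j \<in> {-1..int d}. 0 \<le> int n - j}. a j n * F (nat (int n - j)))"
    and DG: "\<And>n. DG n = (\<Sum>j \<in> {j \<in> {-1..int d}. 0 \<le> int n + j}.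
                 a j (nat (int n + j)) * G (nat (int n + j)))"
    and N: "d \<le> N" "1 \<le> N"
  shows "(\<Sum>n<N. DF n * G n - F n * DG n) =
    a (-1) (N - 1) * F N * G (N - 1)
      - (\<Sum>j = 1..d. \<Sum>k = 0..j - 1. a (int j) (N + k) * G (N + k) * F (N + k - j))"
proof -
  \<comment> \<open>Each product is labelled by the argument at which its coefficient is evaluated:
    \<open>b j m\<close> couples \<open>G m\<close> to \<open>F (m - j)\<close>, and
    \<open>c m\<close> couples \<open>G m\<close> to \<open>F (m + 1)\<close>. In these labels both
    halves of the commutator consist of the same terms, only shifted.\<close>
  define b where "b j m = a (int j) m * G m * F (m - j)" for j m
  define c where "c m = a (-1) m * F (m + 1) * G m" for m
  have DF': "DF n * G n = c n + (\<Sum>j\<le>d. if j \<le> n then b j n else 0)" for n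
  proof -
    have "DF n = a (-1) n * F (n + 1) + (\<Sum>j\<le>d. if j \<le> n then a (int j) n * F (n - j) else 0)"
      unfolding DF sum_down_guarded
      by (intro arg_cong2[where f = "(+)"] sum.cong) (auto simp: nat_add_distrib nat_diff_distrib)
    then show ?thesis
      unfolding b_def c_def
      by (simp only: distrib_right sum_distrib_right) (auto simp: mult_ac intro!: sum.cong)
  qed
  have DG': "F n * DG n = (if 1 \<le> n then c (n - 1) else 0) + (\<Sum>j\<le>d. b j (n + j))" for n
  proof -
    have "nat (int n - 1) = n - 1" by simp
    then have "DG n = (if 1 \<le> n then a (-1) (n - 1) * G (n - 1) else 0)
        + (\<Sum>j\<le>d. a (int j) (n + j) * G (n + j))"
      unfolding DG sum_up_guarded
      by (intro arg_cong2[where f = "(+)"] sum.cong) (auto simp: nat_add_distrib)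
    then show ?thesis
      unfolding b_def c_def
      by (simp only: distrib_left sum_distrib_left) (auto simp: mult_ac intro!: sum.cong)
  qed
  obtain M where M: "N = Suc M" using N by (cases N) auto
  \<comment> \<open>The part with index \<open>-1\<close> telescopes: at \<open>n = 0\<close> there
    is no \<open>c (n - 1)\<close>, so the second sum of \<open>c\<close> stops one term earlier
    than the first and leaves \<open>c (N - 1)\<close>.\<close>
  have "(\<Sum>n<N. if 1 \<le> n then c (n - 1) else 0) = (\<Sum>n<M. c n)"
    unfolding M by (subst sum.lessThan_Suc_shift) simp
  then have c: "(\<Sum>n<N. c n) - (\<Sum>n<N. if 1 \<le> n then c (n - 1) else 0) = c (N - 1)"
    by (simp add: M)
  have "(\<Sum>n<N. DF n * G n - F n * DG n) =
      c (N - 1) + ((\<Sum>n<N. \<Sum>j\<le>d. if j \<le> n then b j n else 0) - (\<Sum>n<N. \<Sum>j\<le>d. b j (n + j)))"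
    by (simp only: DF' DG' sum_subtractf sum.distrib c[symmetric]) (simp only: algebra_simps)
  also have "(\<Sum>n<N. \<Sum>j\<le>d. if j \<le> n then b j n else 0) - (\<Sum>n<N. \<Sum>j\<le>d. b j (n + j)) =
      (\<Sum>j\<le>d. (\<Sum>n<N. if j \<le> n then b j n else 0) - (\<Sum>n<N. b j (n + j)))"
    by (subst (1 2) sum.swap) (simp add: sum_subtractf)
  also have "\<dots> = - (\<Sum>j\<le>d. \<Sum>k<j. b j (N + k))"
    using N by (simp add: sum_shift_diff sum_negf)
  \<comment> \<open>For \<open>j = 0\<close> the left inner sum is empty, while truncated
    subtraction would make \<open>{0..j - 1}\<close> equal to \<open>{0}\<close>; hence the outer
    range on the right starts at \<open>1\<close>.\<close>
  also have "(\<Sum>j\<le>d. \<Sum>k<j. b j (N + k)) = (\<Sum>j = 1..d. \<Sum>k = 0..j - 1. b j (N + k))"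
  proof (rule sum.mono_neutral_cong_right)
    fix j assume "j \<in> {1..d}"
    then have "{..<j} = {0..j - 1}" by auto
    then show "(\<Sum>k<j. b j (N + k)) = (\<Sum>k = 0..j - 1. b j (N + k))" by simp
  qed (auto simp: not_le)
  finally show ?thesis
    using N by (simp add: b_def c_def)
qed

section \<open>Matrix form\<close>

lemma row_mat_col_eq_sum:
  assumes "dim_vec x = m" "dim_vec y = n" "dim_row A = m" "dim_col A = n"
  shows "row_mat_col x A y = (\<Sum>i<m. \<Sum>c<n. x $ i * A $$ (i, c) * y $ c)"
  using assms
  by (auto simp: row_mat_col_def scalar_prod_def lessThan_atLeast0 sum_distrib_left mult.assoc
      intro!: sum.cong)

lemma row_mat_col_transpose:
  assumes "dim_vec x = dim_row A" "dim_vec y = dim_col A"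
  shows "row_mat_col y (transpose_mat A) x = row_mat_col x A y"
proof -
  have "row_mat_col y (transpose_mat A) x =
      (\<Sum>c<dim_col A. \<Sum>i<dim_row A. y $ c * transpose_mat A $$ (c, i) * x $ i)"
    by (rule row_mat_col_eq_sum) (use assms in auto)
  also have "\<dots> = (\<Sum>i<dim_row A. \<Sum>c<dim_col A. x $ i * A $$ (i, c) * y $ c)"
    by (subst sum.swap) (auto intro!: sum.cong simp: mult_ac)
  also have "\<dots> = row_mat_col x A y"
    by (rule row_mat_col_eq_sum[symmetric]) (use assms in auto)
  finally show ?thesis .
qed

text \<open>The corner entry in row \<open>0\<close> and column \<open>d\<close> gives the \<gamma>
  term. Row \<open>k + 1\<close> meets \<open>g (N + k)\<close> and column \<open>c\<close> meets
  \<open>f (N - d + c)\<close>; the substitution \<open>j = d + k - c\<close> turns the latter into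
  \<open>f (N + k - j)\<close> and the range \<open>k \<le> c < d\<close> into
  \<open>k < j \<le> d\<close>. The bound \<open>d \<le> N\<close> prevents truncation of the window
  indices.\<close>

lemma row_mat_col_cd_matrix:
  assumes N: "d \<le> N" "1 \<le> N"
  shows "row_mat_col (upper_window d g (N - 1) t) (cd_matrix d \<gamma> a N) (lower_window d f N s) =
    (\<Sum>j = 1..d. \<Sum>k = 0..j - 1. a (int j) (N + k) * g (N + k) t * f (N + k - j) s)
      - \<gamma> (N - 1) * f N s * g (N - 1) t"
proof -
  define e where "e k j = a (int j) (N + k) * g (N + k) t * f (N + k - j) s" for k j
  have row: "(\<Sum>c<d. if k \<le> c then g (N + k) t * a (int d + int k - int c) (N + k) * f (N - d + c) s else 0)
      = (\<Sum>j\<in>{k<..d}. e k j)" if "k < d" for k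
  proof -
    have "(\<Sum>c<d. if k \<le> c then g (N + k) t * a (int d + int k - int c) (N + k) * f (N - d + c) s else 0)
      = (\<Sum>c\<in>{k..<d}. g (N + k) t * a (int d + int k - int c) (N + k) * f (N - d + c) s)"
      by (rule sum.mono_neutral_cong_right) auto
    also have "\<dots> = (\<Sum>j\<in>{k<..d}. e k j)"
      by (rule sum.reindex_bij_witness[where i = "\<lambda>j. d + k - j" and j = "\<lambda>c. d + k - c"])
        (use N in \<open>auto simp: e_def of_nat_diff mult_ac\<close>)
    finally show ?thesis .
  qed
  have "row_mat_col (upper_window d g (N - 1) t) (cd_matrix d \<gamma> a N) (lower_window d f N s) =
      (\<Sum>i<Suc d. \<Sum>c<Suc d. g (N - 1 + i) t * cd_matrix d \<gamma> a N $$ (i, c) * f (N - d + c) s)"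
    by (subst row_mat_col_eq_sum[where m = "Suc d" and n = "Suc d"])
      (auto simp: upper_window_def lower_window_def cd_matrix_def intro!: sum.cong)
  also have "\<dots> = (\<Sum>c<Suc d. g (N - 1) t * cd_matrix d \<gamma> a N $$ (0, c) * f (N - d + c) s) +
      (\<Sum>k<d. \<Sum>c<Suc d. g (N - 1 + Suc k) t * cd_matrix d \<gamma> a N $$ (Suc k, c) * f (N - d + c) s)"
    by (subst sum.lessThan_Suc_shift) simp
  also have "(\<Sum>c<Suc d. g (N - 1) t * cd_matrix d \<gamma> a N $$ (0, c) * f (N - d + c) s) =
      - \<gamma> (N - 1) * f N s * g (N - 1) t"
    using N by (simp add: cd_matrix_def)
  also have "(\<Sum>k<d. \<Sum>c<Suc d. g (N - 1 + Suc k) t * cd_matrix d \<gamma> a N $$ (Suc k, c) * f (N - d + c) s) =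
      (\<Sum>k<d. \<Sum>j\<in>{k<..d}. e k j)"
  proof (rule sum.cong[OF refl])
    fix k assume "k \<in> {..<d}"
    then have k: "k < d" by simp
    show "(\<Sum>c<Suc d. g (N - 1 + Suc k) t * cd_matrix d \<gamma> a N $$ (Suc k, c) * f (N - d + c) s) =
        (\<Sum>j\<in>{k<..d}. e k j)"
      unfolding row[OF k, symmetric] using k N by (auto simp: cd_matrix_def intro!: sum.cong)
  qed
  \<comment> \<open>Both sides sum over the triangle \<open>0 \<le> k < j \<le> d\<close>, in
    opposite orders.\<close>
  also have "\<dots> = (\<Sum>j = 1..d. \<Sum>k = 0..j - 1. e k j)"
    by (subst sum.Sigma, simp, simp, subst sum.Sigma, simp, simp)
      (rule sum.reindex_bij_witness[where i = prod.swap and j = prod.swap]; auto)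
  finally show ?thesis by (simp add: e_def)
qed

section \<open>Contour integrals\<close>

lemma cint_sum:
  assumes "finite A" "\<And>j. j \<in> A \<Longrightarrow> cint_converges \<Gamma> (f j)"
  shows "cint \<Gamma> (\<lambda>x. \<Sum>j\<in>A. c j * f j x) = (\<Sum>j\<in>A. c j * cint \<Gamma> (f j))"
  using assms(2)
proof (induction \<Gamma>)
  case Nil
  then show ?case by (simp add: cint_def)
next
  case (Cons wg \<Gamma>)
  obtain w g where wg: "wg = (w, g)" by fastforce
  have "integrable lborel (\<lambda>t. f j (g t) * vector_derivative g (at t))" if "j \<in> A" for j
    using Cons.prems[OF that] by (auto simp: cint_converges_def wg)
  then have "(LINT t|lborel. (\<Sum>j\<in>A. c j * f j (g t)) * vector_derivative g (at t)) =
      (\<Sum>j\<in>A. c j * (LINT t|lborel. f j (g t) * vector_derivative g (at t)))"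
    by (simp add: sum_distrib_right mult.assoc)
  moreover have "cint \<Gamma> (\<lambda>x. \<Sum>j\<in>A. c j * f j x) = (\<Sum>j\<in>A. c j * cint \<Gamma> (f j))"
    by (rule Cons.IH) (use Cons.prems in \<open>auto simp: cint_converges_def\<close>)
  ultimately show ?case
    by (simp add: cint_def wg distrib_left sum.distrib sum_distrib_left mult.left_commute)
qed

text \<open>The left side coincides with one of the four positive summands. If \<open>a\<close> and
  \<open>b\<close> are the real and imaginary parts of \<open>z\<close>, the exponents on the right
  are the real parts of \<open>z * c\<close> for \<open>c = 1 - \<i>\<close>,
  \<open>1 + \<i>\<close>, \<open>-1 - \<i>\<close>, \<open>-1 + \<i>\<close>, in this
  order.\<close>

lemma exp_abs_le_sum_exp:
  fixes a b :: real
  shows "exp (\<bar>a\<bar> + \<bar>b\<bar>) \<le> exp (a + b) + exp (a - b) + exp (b - a) + exp (- a - b)"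
proof -
  have "\<bar>a\<bar> + \<bar>b\<bar> \<in> {a + b, a - b, b - a, - a - b}" by auto
  then show ?thesis by (auto intro: add_nonneg_nonneg add_increasing add_increasing2)
qed

text \<open>Integrability is known only for each \<open>y\<close> separately. Since it holds at
  every complex \<open>y\<close>, a bound that is uniform near a given \<open>y\<close> can be
  assembled from finitely many shifted integrands.\<close>

lemma has_field_derivative_integral_exp:
  fixes g w :: "'a \<Rightarrow> complex"
  assumes int: "\<And>k y. k \<le> 2 \<Longrightarrow> integrable M (\<lambda>t. g t ^ k * w t * exp (g t * y))"
  shows "((\<lambda>y. LINT t|M. w t * exp (g t * y)) has_field_derivative
    (LINT t|M. g t * w t * exp (g t * y))) (at y)"
proof -
  let ?F = "\<lambda>y. LINT t|M. w t * exp (g t * y)"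
  let ?D = "LINT t|M. g t * w t * exp (g t * y)"
  \<comment> \<open>Taylor remainder: for \<open>norm h \<le> 1\<close> the difference quotient is off by at most \<open>norm h\<close> times the
    integral of \<open>norm (g\<^sup>2 * w * exp (g * y)) * exp (norm g)\<close>, and \<open>exp (norm g)\<close> is dominated by the
    sum of the norms of \<open>exp (g * c)\<close> over the four corners \<open>c = \<plusminus>1 \<plusminus> \<i>\<close>.\<close>
  define m where "m c t = norm (g t ^ 2 * w t * exp (g t * (y + c)))" for c t
  define B where "B t = m (Complex 1 (-1)) t + m (Complex 1 1) t + m (Complex (-1) (-1)) t
    + m (Complex (-1) 1) t" for t
  have i0: "integrable M (\<lambda>t. w t * exp (g t * y))" for y
    using int[of 0] by simp
  have i1: "integrable M (\<lambda>t. g t * w t * exp (g t * y))" for y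
    using int[of 1] by simp
  have iB: "integrable M B"
    unfolding B_def m_def by (intro Bochner_Integration.integrable_add integrable_norm int) simp_all
  have remainder: "norm (w t * exp (g t * (y + h)) - w t * exp (g t * y) - h * (g t * w t * exp (g t * y)))
      \<le> (norm h)\<^sup>2 * B t" if "norm h \<le> 1" for h t
  proof -
    let ?z = "h * g t"
    have "norm ?z \<le> norm (g t)"
      using that by (simp add: norm_mult mult_left_le_one_le)
    then have "norm ?z \<le> \<bar>Re (g t)\<bar> + \<bar>Im (g t)\<bar>"
      using cmod_le[of "g t"] by linarith
    then have "exp (norm ?z) \<le> exp (Re (g t) + Im (g t)) + exp (Re (g t) - Im (g t))
        + exp (Im (g t) - Re (g t)) + exp (- Re (g t) - Im (g t))" (is "_ \<le> ?E")
      using exp_abs_le_sum_exp[of "Re (g t)" "Im (g t)"] by (meson exp_le_cancel_iff order_trans)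
    moreover have "norm (exp ?z - (1 + ?z)) \<le> exp (norm ?z) * (norm ?z)\<^sup>2"
      using Taylor_exp_field[of ?z 1] by (simp add: numeral_2_eq_2)
    ultimately have "norm (exp ?z - (1 + ?z)) \<le> ?E * (norm ?z)\<^sup>2"
      by (meson mult_right_mono order_trans zero_le_power2)
    then have "norm (w t * exp (g t * y)) * norm (exp ?z - (1 + ?z))
        \<le> norm (w t * exp (g t * y)) * (?E * (norm ?z)\<^sup>2)"
      by (rule mult_left_mono) simp
    also have "norm (w t * exp (g t * y)) * norm (exp ?z - (1 + ?z)) =
        norm (w t * exp (g t * (y + h)) - w t * exp (g t * y) - h * (g t * w t * exp (g t * y)))"
      unfolding norm_mult[symmetric]
      by (rule arg_cong[where f = norm]) (simp add: algebra_simps exp_add)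
    \<comment> \<open>As \<open>norm (exp z) = exp (Re z)\<close>, each summand of \<open>?E\<close>
      is the norm of \<open>exp (g t * c)\<close> at one corner \<open>c\<close>; together with
      \<open>(norm (g t))\<^sup>2\<close> and the prefactor it becomes \<open>m c t\<close>.\<close>
    also have "norm (w t * exp (g t * y)) * (?E * (norm ?z)\<^sup>2) = (norm h)\<^sup>2 * B t"
      by (simp add: B_def m_def norm_mult norm_power distrib_left exp_add exp_diff
          power_mult_distrib algebra_simps exp_minus divide_inverse)
    finally show ?thesis .
  qed
  define C where "C = (LINT t|M. B t)"
  have quot: "norm ((?F (y + h) - ?F y) / h - ?D) \<le> norm h * C" if "norm h \<le> 1" "h \<noteq> 0" for h
  proof -
    have "norm (?F (y + h) - ?F y - h * ?D) =
        norm (LINT t|M. w t * exp (g t * (y + h)) - w t * exp (g t * y) - h * (g t * w t * exp (g t * y)))"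
      using i0 i1 by simp
    also have "\<dots> \<le> (LINT t|M. (norm h)\<^sup>2 * B t)"
      by (rule order_trans[OF integral_norm_bound integral_mono]) (use i0 i1 iB remainder that in auto)
    finally have le: "norm (?F (y + h) - ?F y - h * ?D) \<le> (norm h)\<^sup>2 * C"
      by (simp add: C_def)
    have "(?F (y + h) - ?F y) / h - ?D = (?F (y + h) - ?F y - h * ?D) / h"
      using that by (simp add: field_simps)
    then show ?thesis
      using le that by (simp add: norm_divide divide_simps power2_eq_square mult_ac)
  qed
  have "((\<lambda>h. (?F (y + h) - ?F y) / h - ?D) \<longlongrightarrow> 0) (at 0)"
  proof (rule Lim_null_comparison)
    show "\<forall>\<^sub>F h in at 0. norm ((?F (y + h) - ?F y) / h - ?D) \<le> norm h * C"
      unfolding eventually_at by (rule exI[of _ 1]) (auto intro: quot)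
    show "((\<lambda>h. norm h * C) \<longlongrightarrow> 0) (at (0::complex))"
      by (auto intro!: tendsto_eq_intros)
  qed
  then show ?thesis
    unfolding DERIV_def by (simp add: LIM_zero_iff)
qed

text \<open>Each curve is an instance of \<open>has_field_derivative_integral_exp\<close>, with its
  velocity absorbed into the weight.\<close>

lemma has_field_derivative_cint_exp:
  assumes conv: "\<And>k y. k \<le> 2 \<Longrightarrow> cint_converges \<Gamma> (\<lambda>x. x ^ k * f x * exp (x * y))"
  shows "((\<lambda>y. cint \<Gamma> (\<lambda>x. f x * exp (x * y))) has_field_derivative
    cint \<Gamma> (\<lambda>x. x * f x * exp (x * y))) (at y)"
  using conv
proof (induction \<Gamma>)
  case Nil
  then show ?case by (simp add: cint_def)
next
  case (Cons wg \<Gamma>)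
  obtain w g where wg: "wg = (w, g)" by fastforce
  have "((\<lambda>y. LINT t|lborel. (f (g t) * vector_derivative g (at t)) * exp (g t * y)) has_field_derivative
     (LINT t|lborel. g t * (f (g t) * vector_derivative g (at t)) * exp (g t * y))) (at y)"
    by (rule has_field_derivative_integral_exp)
      (use Cons.prems in \<open>auto simp: cint_converges_def wg mult_ac\<close>)
  moreover have "((\<lambda>y. cint \<Gamma> (\<lambda>x. f x * exp (x * y))) has_field_derivative
      cint \<Gamma> (\<lambda>x. x * f x * exp (x * y))) (at y)"
    by (rule Cons.IH) (use Cons.prems in \<open>auto simp: cint_converges_def\<close>)
  ultimately show ?case
    by (auto simp: cint_def wg mult_ac intro!: derivative_eq_intros)
qed

section \<open>Dual recursions\<close>

text \<open>This brings the integrand of a dual function into the form of a polynomial times an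
  exponential for which convergence and vanishing boundary terms are assumed.\<close>

lemma exp_mult_wave:
  "exp (x * y) * wave V p r n x = poly (Polynomial.smult (1 / r n) (p n)) x * exp (- V x + x * y)"
  by (simp add: wave_def exp_add[symmetric] mult.left_commute[of "exp _"] add.commute)

lemma potential_field_differentiable: "potential d u field_differentiable at x"
  unfolding potential_def[abs_def]
  by (intro field_differentiable_sum field_differentiable_mult field_differentiable_const
      field_differentiable_power field_differentiable_ident)

text \<open>The derivative recursion is phrased with \<open>deriv\<close>, which says something
  about a derivative only where one exists.\<close>

lemma wave_field_differentiable:
  assumes "V field_differentiable at x"
  shows "wave V p r n field_differentiable at x"
proof -
  from assms obtain D where "(V has_field_derivative D) (at x)"
    by (auto simp: field_differentiable_def)
  then show ?thesis
    unfolding wave_def[abs_def] field_differentiable_def divide_inverse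
    by (intro exI) (rule DERIV_cmult_right DERIV_mult DERIV_chain2[OF DERIV_exp]
        DERIV_minus poly_DERIV | assumption)+
qed

text \<open>Integration by parts: \<open>y * exp (x * y)\<close> is the \<open>x\<close>-derivative
  of the exponential, so multiplication by \<open>y\<close> moves a derivative onto the wave
  function. Its minus sign cancels the one in the derivative recursion.\<close>

lemma dual_multiplication:
  assumes V: "\<And>x. V field_differentiable at x"
    and conv: "\<And>p y. cint_converges \<Gamma> (\<lambda>x. poly p x * exp (- V x + x * y))"
    and parts: "\<And>p y. cint \<Gamma> (deriv (\<lambda>x. poly p x * exp (- V x + x * y))) = 0"
    and rec: "derivative_recursion d a (wave V p r)"
  shows "y * dual \<Gamma> (wave V p r) n y =
    (\<Sum>j \<in> {j \<in> {-1..int d}. 0 \<le> int n + j}.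
       a j (nat (int n + j)) * dual \<Gamma> (wave V p r) (nat (int n + j)) y)"
proof -
  let ?f = "wave V p r"
  let ?J = "{j \<in> {-1..int d}. 0 \<le> int n + j}"
  let ?R = "\<lambda>x. \<Sum>j\<in>?J. a j (nat (int n + j)) * (exp (x * y) * ?f (nat (int n + j)) x)"
  have conv': "cint_converges \<Gamma> (\<lambda>x. exp (x * y) * ?f n x)" for n
    by (simp only: exp_mult_wave conv)
  have deriv_eq: "deriv (\<lambda>x. exp (x * y) * ?f n x) = (\<lambda>x. y * (exp (x * y) * ?f n x) - ?R x)"
  proof
    fix x
    have "(?f n has_field_derivative deriv (?f n) x) (at x)"
      using wave_field_differentiable[OF V] by (simp add: field_differentiable_derivI)
    then have "((\<lambda>x. exp (x * y) * ?f n x) has_field_derivative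
        y * (exp (x * y) * ?f n x) + exp (x * y) * deriv (?f n) x) (at x)"
      by (auto intro!: derivative_eq_intros)
    then have "deriv (\<lambda>x. exp (x * y) * ?f n x) x =
        y * (exp (x * y) * ?f n x) + exp (x * y) * deriv (?f n) x"
      by (rule DERIV_imp_deriv)
    also have "exp (x * y) * deriv (?f n) x = - ?R x"
      using rec by (simp add: derivative_recursion_def sum_distrib_left mult_ac)
    finally show "deriv (\<lambda>x. exp (x * y) * ?f n x) x = y * (exp (x * y) * ?f n x) - ?R x"
      by simp
  qed
  \<comment> \<open>The integrand becomes one finite linear combination indexed by an option type:
    \<open>None\<close> stands for the term with factor \<open>y\<close>, \<open>Some j\<close> for
    the terms of the recursion.\<close>
  define c where "c = case_option y (\<lambda>j. - a j (nat (int n + j)))"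
  define f where "f = case_option (\<lambda>x. exp (x * y) * ?f n x) (\<lambda>j x. exp (x * y) * ?f (nat (int n + j)) x)"
  have "finite ?J" by (rule finite_subset[of _ "{-1..int d}"]) auto
  then have fin: "finite (insert None (Some ` ?J))" by simp
  have expand: "(\<Sum>i\<in>insert None (Some ` ?J). T i) = T None + (\<Sum>j\<in>?J. T (Some j))"
    for T :: "int option \<Rightarrow> complex"
    using \<open>finite ?J\<close> by (subst sum.insert) (auto simp: sum.reindex)
  have "0 = cint \<Gamma> (deriv (\<lambda>x. exp (x * y) * ?f n x))"
    by (simp only: exp_mult_wave parts)
  also have "\<dots> = cint \<Gamma> (\<lambda>x. \<Sum>i\<in>insert None (Some ` ?J). c i * f i x)"
    by (simp only: deriv_eq expand) (simp add: c_def f_def sum_negf)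
  also have "\<dots> = (\<Sum>i\<in>insert None (Some ` ?J). c i * cint \<Gamma> (f i))"
    by (rule cint_sum[OF fin]) (auto simp: f_def conv')
  also have "\<dots> = y * dual \<Gamma> ?f n y - (\<Sum>j\<in>?J. a j (nat (int n + j)) * dual \<Gamma> ?f (nat (int n + j)) y)"
    by (simp only: expand) (simp add: c_def f_def dual_def sum_negf)
  finally show ?thesis by simp
qed

text \<open>Differentiating \<open>exp (x * y)\<close> in \<open>y\<close> under the integral
  produces a factor \<open>x\<close>, which the multiplication recursion expands.\<close>

lemma dual_has_field_derivative:
  assumes conv: "\<And>p y. cint_converges \<Gamma> (\<lambda>x. poly p x * exp (- V x + x * y))"
    and rec: "multiplication_recursion d a (wave V p r)"
  shows "(dual \<Gamma> (wave V p r) n has_field_derivative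
    (\<Sum>j \<in> {j \<in> {-1..int d}. 0 \<le> int n - j}. a j n * dual \<Gamma> (wave V p r) (nat (int n - j)) y)) (at y)"
proof -
  let ?f = "wave V p r"
  have conv': "cint_converges \<Gamma> (\<lambda>x. exp (x * y) * ?f n x)" for n y
    by (simp only: exp_mult_wave conv)
  have "cint_converges \<Gamma> (\<lambda>x. x ^ k * ?f n x * exp (x * y))" for k y
  proof -
    have "x ^ k * ?f n x * exp (x * y) =
        poly (Polynomial.monom (1 / r n) k * p n) x * exp (- V x + x * y)" for x
      by (simp only: wave_def exp_add poly_monom poly_mult) simp
    then show ?thesis by (simp only: conv)
  qed
  then have "((\<lambda>y. cint \<Gamma> (\<lambda>x. ?f n x * exp (x * y))) has_field_derivative
      cint \<Gamma> (\<lambda>x. x * ?f n x * exp (x * y))) (at y)"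
    by (rule has_field_derivative_cint_exp)
  also have "(\<lambda>y. cint \<Gamma> (\<lambda>x. ?f n x * exp (x * y))) = dual \<Gamma> ?f n"
    by (simp add: dual_def mult.commute fun_eq_iff)
  also have "(\<lambda>x. x * ?f n x * exp (x * y)) =
      (\<lambda>x. \<Sum>j \<in> {j \<in> {-1..int d}. 0 \<le> int n - j}. a j n * (exp (x * y) * ?f (nat (int n - j)) x))"
    using rec by (simp add: multiplication_recursion_def sum_distrib_left mult_ac)
  also have "cint \<Gamma> \<dots> =
      (\<Sum>j \<in> {j \<in> {-1..int d}. 0 \<le> int n - j}. a j n * dual \<Gamma> ?f (nat (int n - j)) y)"
    unfolding dual_def
    by (rule cint_sum) (auto intro: finite_subset[of _ "{-1..int d}"] conv')
  finally show ?thesis .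
qed

section \<open>Christoffel--Darboux relations\<close>

text \<open>Multiplication by \<open>s\<close> acts on \<open>f\<close> through the band and
  multiplication by \<open>t\<close> on \<open>g\<close> through its transpose, so
  \<open>s - t\<close> times the kernel is the commutator sum. Keeping \<open>g\<close> abstract
  lets this serve both kernels.\<close>

lemma christoffel_darboux:
  assumes f: "multiplication_recursion d a f"
    and g: "\<And>n. t * g n t =
      (\<Sum>j \<in> {j \<in> {-1..int d}. 0 \<le> int n + j}. a j (nat (int n + j)) * g (nat (int n + j)) t)"
    and \<gamma>: "\<And>n. a (-1) n = \<gamma> n"
    and N: "d \<le> N" "1 \<le> N"
  shows "(s - t) * kernel f g N s t =
      \<gamma> (N - 1) * f N s * g (N - 1) t -
      (\<Sum>j = 1..d. \<Sum>k = 0..j - 1. a (int j) (N + k) * g (N + k) t * f (N + k - j) s)" (is ?scalar)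
    and "(s - t) * kernel f g N s t =
      - row_mat_col (upper_window d g (N - 1) t) (cd_matrix d \<gamma> a N) (lower_window d f N s)" (is ?matrix)
proof -
  have f': "s * f n s = (\<Sum>j \<in> {j \<in> {-1..int d}. 0 \<le> int n - j}. a j n * f (nat (int n - j)) s)" for n
    using f by (simp add: multiplication_recursion_def)
  have "(s - t) * kernel f g N s t = (\<Sum>n<N. (s * f n s) * g n t - f n s * (t * g n t))"
    by (simp add: kernel_def sum_distrib_left algebra_simps)
  also note band_commutator_sum[OF f' g N]
  finally show ?scalar by (simp add: \<gamma>)
  then show ?matrix by (simp only: row_mat_col_cd_matrix[OF N]) simp
qed

text \<open>Here the band acts on \<open>g\<close> as the \<open>t\<close>-derivative, and minus its
  transpose acts on \<open>f\<close> as the \<open>s\<close>-derivative. That sign turns the sum of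
  the two derivatives into a commutator.\<close>

lemma differential_christoffel_darboux:
  assumes f: "derivative_recursion d a f"
    and f_diff: "\<And>n. f n field_differentiable at s"
    and g: "\<And>n. (g n has_field_derivative
      (\<Sum>j \<in> {j \<in> {-1..int d}. 0 \<le> int n - j}. a j n * g (nat (int n - j)) t)) (at t)"
    and \<gamma>: "\<And>n. a (-1) n = \<gamma> n"
    and N: "d \<le> N" "1 \<le> N"
  shows "(\<lambda>t. kernel f g N s t) field_differentiable at t"
    and "(\<lambda>s. kernel f g N s t) field_differentiable at s"
    and "deriv (\<lambda>t. kernel f g N s t) t + deriv (\<lambda>s. kernel f g N s t) s =
      - row_mat_col (lower_window d g N t) (transpose_mat (cd_matrix d \<gamma> a N))
          (upper_window d f (N - 1) s)"
proof -
  define Df where "Df n = (\<Sum>j \<in> {j \<in> {-1..int d}. 0 \<le> int n + j}.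
      a j (nat (int n + j)) * f (nat (int n + j)) s)" for n
  define Dg where "Dg n = (\<Sum>j \<in> {j \<in> {-1..int d}. 0 \<le> int n - j}. a j n * g (nat (int n - j)) t)" for n
  have f': "(f n has_field_derivative - Df n) (at s)" for n
    using field_differentiable_derivI[OF f_diff[of n]] f by (simp add: derivative_recursion_def Df_def)
  have g': "(g n has_field_derivative Dg n) (at t)" for n
    unfolding Dg_def by (rule g)
  have kt: "((\<lambda>t. kernel f g N s t) has_field_derivative (\<Sum>n<N. f n s * Dg n)) (at t)"
    unfolding kernel_def by (intro DERIV_sum DERIV_cmult g')
  have ks: "((\<lambda>s. kernel f g N s t) has_field_derivative (\<Sum>n<N. - Df n * g n t)) (at s)"
    unfolding kernel_def by (intro DERIV_sum DERIV_cmult_right f')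
  show "(\<lambda>t. kernel f g N s t) field_differentiable at t" "(\<lambda>s. kernel f g N s t) field_differentiable at s"
    using kt ks by (auto simp: field_differentiable_def)
  have "deriv (\<lambda>t. kernel f g N s t) t + deriv (\<lambda>s. kernel f g N s t) s =
      (\<Sum>n<N. Dg n * f n s - g n t * Df n)"
    using DERIV_imp_deriv[OF kt] DERIV_imp_deriv[OF ks]
    by (simp add: sum_subtractf sum_negf mult.commute)
  \<comment> \<open>Compared with \<open>christoffel_darboux\<close> the roles are exchanged:
    \<open>F\<close> is \<open>g\<close> at \<open>t\<close> and \<open>G\<close> is
    \<open>f\<close> at \<open>s\<close>. The upper window thus belongs to \<open>f\<close>, and
    putting \<open>g\<close> on the left transposes the matrix.\<close>
  also note band_commutator_sum[where DF = Dg and DG = Df, OF Dg_def Df_def N]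
  also have "a (-1) (N - 1) * g N t * f (N - 1) s
      - (\<Sum>j = 1..d. \<Sum>k = 0..j - 1. a (int j) (N + k) * f (N + k) s * g (N + k - j) t) =
      - row_mat_col (upper_window d f (N - 1) s) (cd_matrix d \<gamma> a N) (lower_window d g N t)"
    by (simp only: row_mat_col_cd_matrix[OF N] \<gamma>) simp
  also have "\<dots> = - row_mat_col (lower_window d g N t) (transpose_mat (cd_matrix d \<gamma> a N))
      (upper_window d f (N - 1) s)"
    by (subst row_mat_col_transpose) (simp_all add: upper_window_def lower_window_def cd_matrix_def)
  finally show "deriv (\<lambda>t. kernel f g N s t) t + deriv (\<lambda>s. kernel f g N s t) s =
      - row_mat_col (lower_window d g N t) (transpose_mat (cd_matrix d \<gamma> a N))
          (upper_window d f (N - 1) s)" .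
qed

theorem proposition2p1:
  fixes d1 d2 :: nat
    and u v :: "nat \<Rightarrow> complex"
    and V1 V2 :: "complex \<Rightarrow> complex"
    and \<Gamma>x \<Gamma>y :: contour
    and P S :: "nat \<Rightarrow> complex poly"
    and h r \<gamma> :: "nat \<Rightarrow> complex"
    and \<psi> \<phi> \<psi>_dual \<phi>_dual :: "nat \<Rightarrow> complex \<Rightarrow> complex"
    and \<alpha> \<beta> :: "int \<Rightarrow> nat \<Rightarrow> complex"
    and K11 K22 :: "nat \<Rightarrow> complex \<Rightarrow> complex \<Rightarrow> complex"
    and \<A> \<B> :: "nat \<Rightarrow> complex Matrix.mat"
  assumes "d1 \<ge> 1" and "d2 \<ge> 1"
    and "u (d1 + 1) \<noteq> 0" and "v (d2 + 1) \<noteq> 0"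
    and V1: "V1 = potential d1 u"
    and V2: "V2 = potential d2 v"
    and contours: "admissible_contours V1 V2 \<Gamma>x \<Gamma>y"
    and monic: "\<And>n. monic_of_degree (P n) n" "\<And>n. monic_of_degree (S n) n"
    and biorth: "\<And>n m. pairing V1 V2 \<Gamma>x \<Gamma>y (P n) (S m) = (if n = m then h n else 0)"
    and h: "\<And>n. h n \<noteq> 0"
    and sqrt_h: "\<And>n. r n ^ 2 = h n"
    and \<psi>: "\<psi> = wave V1 P r"
    and \<phi>: "\<phi> = wave V2 S r"
    and \<psi>_dual: "\<psi>_dual = dual \<Gamma>x \<psi>"
    and \<phi>_dual: "\<phi>_dual = dual \<Gamma>y \<phi>"
    and \<gamma>: "\<gamma> = (\<lambda>n. r (n + 1) / r n)"
    and \<alpha>\<beta>_minus1: "\<And>n. \<alpha> (-1) n = \<gamma> n" "\<And>n. \<beta> (-1) n = \<gamma> n"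
    and \<alpha>_zero: "\<And>j n. j \<le> int d2 \<Longrightarrow> int n < j \<Longrightarrow> \<alpha> j n = 0"
    and \<beta>_zero: "\<And>j n. j \<le> int d1 \<Longrightarrow> int n < j \<Longrightarrow> \<beta> j n = 0"
    and x_\<psi>: "multiplication_recursion d2 \<alpha> \<psi>"
    and dx_\<psi>: "derivative_recursion d1 \<beta> \<psi>"
    and y_\<phi>: "multiplication_recursion d1 \<beta> \<phi>"
    and dy_\<phi>: "derivative_recursion d2 \<alpha> \<phi>"
    and K11: "K11 = kernel \<psi> \<phi>_dual"
    and K22: "K22 = kernel \<psi>_dual \<phi>"
    and \<A>: "\<A> = cd_matrix d2 \<gamma> \<alpha>"
    and \<B>: "\<B> = cd_matrix d1 \<gamma> \<beta>"
  shows
    "(\<forall>N x x'. N \<ge> d2 \<longrightarrow>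
        (x - x') * K11 N x x' =
          \<gamma> (N - 1) * \<psi> N x * \<phi>_dual (N - 1) x' -
          (\<Sum>j = 1..d2. \<Sum>k = 0..j - 1.
             \<alpha> (int j) (N + k) * \<phi>_dual (N + k) x' * \<psi> (N + k - j) x) \<and>
        (x - x') * K11 N x x' =
          - row_mat_col (upper_window d2 \<phi>_dual (N - 1) x') (\<A> N) (lower_window d2 \<psi> N x)) \<and>
     (\<forall>N y' y. N \<ge> d1 \<longrightarrow>
        (y' - y) * K22 N y' y =
          - \<gamma> (N - 1) * \<psi>_dual (N - 1) y' * \<phi> N y +
          (\<Sum>j = 1..d1. \<Sum>k = 0..j - 1.
             \<beta> (int j) (N + k) * \<psi>_dual (N + k) y' * \<phi> (N + k - j) y) \<and>
        (y' - y) * K22 N y' y =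
          row_mat_col (upper_window d1 \<psi>_dual (N - 1) y') (\<B> N) (lower_window d1 \<phi> N y)) \<and>
     (\<forall>N x x'. N \<ge> d1 \<longrightarrow>
        (\<lambda>s. K11 N x s) field_differentiable at x' \<and>
        (\<lambda>s. K11 N s x') field_differentiable at x \<and>
        deriv (\<lambda>s. K11 N x s) x' + deriv (\<lambda>s. K11 N s x') x =
          - row_mat_col (lower_window d1 \<phi>_dual N x') (transpose_mat (\<B> N))
              (upper_window d1 \<psi> (N - 1) x)) \<and>
     (\<forall>N y' y. N \<ge> d2 \<longrightarrow>
        (\<lambda>s. K22 N s y) field_differentiable at y' \<and>
        (\<lambda>s. K22 N y' s) field_differentiable at y \<and>
        deriv (\<lambda>s. K22 N s y) y' + deriv (\<lambda>s. K22 N y' s) y =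
          - row_mat_col (lower_window d2 \<psi>_dual N y') (transpose_mat (\<A> N))
              (upper_window d2 \<phi> (N - 1) y))"
proof -
  have kernel_swap: "kernel f g N s t = kernel g f N t s" for f g N s t
    by (simp add: kernel_def mult.commute)
  have V: "V1 field_differentiable at x" "V2 field_differentiable at x" for x
    by (simp_all add: V1 V2 potential_field_differentiable)
  note adm = contours[unfolded admissible_contours_def]
  have conv1: "cint_converges \<Gamma>x (\<lambda>x. poly p x * exp (- V1 x + x * y))" for p y
    using adm by blast
  have conv2: "cint_converges \<Gamma>y (\<lambda>y. poly q y * exp (- V2 y + y * x))" for q x
    using adm by (simp add: mult.commute[of _ x])
  have parts1: "cint \<Gamma>x (deriv (\<lambda>x. poly p x * exp (- V1 x + x * y))) = 0" for p y
    using adm by blast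
  have parts2: "cint \<Gamma>y (deriv (\<lambda>y. poly q y * exp (- V2 y + y * x))) = 0" for q x
    using adm by (simp add: mult.commute[of _ x])
  \<comment> \<open>The derivative recursion of \<psi> makes \<open>\<psi>_dual\<close> follow the
    transposed \<beta> band, matching multiplication on \<phi>; symmetrically
    \<open>\<phi>_dual\<close> follows the transposed \<alpha> band. For derivatives of the duals,
    \<open>\<psi>_dual\<close> uses \<alpha> and \<open>\<phi>_dual\<close> uses \<beta>.\<close>
  note mult1 = dual_multiplication[OF V(1) conv1 parts1 dx_\<psi>[unfolded \<psi>], folded \<psi>, folded \<psi>_dual]
  note mult2 = dual_multiplication[OF V(2) conv2 parts2 dy_\<phi>[unfolded \<phi>], folded \<phi>, folded \<phi>_dual]
  note der1 = dual_has_field_derivative[OF conv1 x_\<psi>[unfolded \<psi>], folded \<psi>, folded \<psi>_dual]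
  note der2 = dual_has_field_derivative[OF conv2 y_\<phi>[unfolded \<phi>], folded \<phi>, folded \<phi>_dual]
  have diff: "\<psi> n field_differentiable at x" "\<phi> n field_differentiable at x" for n x
    by (simp_all add: \<psi> \<phi> wave_field_differentiable V)
  \<comment> \<open>This makes \<open>N - 1\<close> a genuine predecessor.\<close>
  have N1: "1 \<le> N" if "d1 \<le> N \<or> d2 \<le> N" for N
    using that \<open>1 \<le> d1\<close> \<open>1 \<le> d2\<close> by linarith
  \<comment> \<open>\<open>K22\<close> lists the dual sequence first, the general relations list it
    second. Exchanging the arguments reverses the sign of \<open>y' - y\<close>, which
    \<open>neg\<close> accounts for.\<close>
  have K22': "K22 N s t = kernel \<phi> \<psi>_dual N t s" for N s t
    by (simp add: K22 kernel_swap)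
  have neg: "(y' - y) * K = - c" if "(y - y') * K = c" for y y' K c :: complex
    using that by (simp add: algebra_simps)
  show ?thesis
  proof (intro conjI allI impI; (unfold K11 \<A> \<B> K22')?)
    fix N x x' assume N: "d2 \<le> N"
    note cd = christoffel_darboux[OF x_\<psi> mult2 \<alpha>\<beta>_minus1(1) N N1]
    show "(x - x') * kernel \<psi> \<phi>_dual N x x' =
          \<gamma> (N - 1) * \<psi> N x * \<phi>_dual (N - 1) x' -
          (\<Sum>j = 1..d2. \<Sum>k = 0..j - 1.
             \<alpha> (int j) (N + k) * \<phi>_dual (N + k) x' * \<psi> (N + k - j) x)"
      using N by (intro cd(1)) simp
    show "(x - x') * kernel \<psi> \<phi>_dual N x x' =
          - row_mat_col (upper_window d2 \<phi>_dual (N - 1) x') (cd_matrix d2 \<gamma> \<alpha> N) (lower_window d2 \<psi> N x)"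
      using N by (intro cd(2)) simp
  next
    fix N y' y assume N: "d1 \<le> N"
    note cd = christoffel_darboux[OF y_\<phi> mult1 \<alpha>\<beta>_minus1(2) N N1, THEN neg]
    show "(y' - y) * kernel \<phi> \<psi>_dual N y y' =
          - \<gamma> (N - 1) * \<psi>_dual (N - 1) y' * \<phi> N y +
          (\<Sum>j = 1..d1. \<Sum>k = 0..j - 1.
             \<beta> (int j) (N + k) * \<psi>_dual (N + k) y' * \<phi> (N + k - j) y)"
      using N by (subst cd(1)) (simp_all add: mult_ac)
    show "(y' - y) * kernel \<phi> \<psi>_dual N y y' =
          row_mat_col (upper_window d1 \<psi>_dual (N - 1) y') (cd_matrix d1 \<gamma> \<beta> N) (lower_window d1 \<phi> N y)"
      using N by (subst cd(2)) simp_all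
  next
    fix N x x' assume N: "d1 \<le> N"
    note cd = differential_christoffel_darboux[OF dx_\<psi> diff(1) der2 \<alpha>\<beta>_minus1(2) N N1]
    show "(\<lambda>s. kernel \<psi> \<phi>_dual N x s) field_differentiable at x'"
      "(\<lambda>s. kernel \<psi> \<phi>_dual N s x') field_differentiable at x"
      "deriv (\<lambda>s. kernel \<psi> \<phi>_dual N x s) x' + deriv (\<lambda>s. kernel \<psi> \<phi>_dual N s x') x =
          - row_mat_col (lower_window d1 \<phi>_dual N x') (transpose_mat (cd_matrix d1 \<gamma> \<beta> N))
              (upper_window d1 \<psi> (N - 1) x)"
      using N by (intro cd; simp)+
  next
    fix N y' y assume N: "d2 \<le> N"
    note cd = differential_christoffel_darboux[OF dy_\<phi> diff(2) der1 \<alpha>\<beta>_minus1(1) N N1]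
    show "(\<lambda>s. kernel \<phi> \<psi>_dual N y s) field_differentiable at y'"
      "(\<lambda>s. kernel \<phi> \<psi>_dual N s y') field_differentiable at y"
      "deriv (\<lambda>s. kernel \<phi> \<psi>_dual N y s) y' + deriv (\<lambda>s. kernel \<phi> \<psi>_dual N s y') y =
          - row_mat_col (lower_window d2 \<psi>_dual N y') (transpose_mat (cd_matrix d2 \<gamma> \<alpha> N))
              (upper_window d2 \<phi> (N - 1) y)"
      using N by (intro cd; simp)+
  qed
qed

end
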